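(* For all $\tau\in\mathbb{H}$, $$1+l(\tau)-2l(\tau)l(2\tau)-l(\tau)l(2\tau)^2+l(\tau)^2l(2\tau)^2=0.$$
   Context: For $\tau\in\mathbb{H}$ put $q=e^{2\pi i\tau}$ and let $r(\tau)=q^{1/5}\prod_{n\ge1}\frac{(1-q^{5n-1})(1-q^{5n-4})}{(1-q^{5n-2})(1-q^{5n-3})}$ be the Rogers–Ramanujan continued fraction. Define $l(\tau)=r(2\tau)/r(\tau)^2$. *)

theory Defs
  imports "HOL-Analysis.Analysis"
begin

definition nome :: "complex \<Rightarrow> complex" where
  "nome \<tau> = exp (2 * of_real pi * \<i> * \<tau>)"

text \<open>
  The fractional power $q^{1/5}$ is $e^{2\pi i\tau/5}$, a holomorphic function of $\tau$, and not the
  principal fifth root of $q$. The product index $n \ge 1$ is written \<open>Suc n\<close>, so the natural-number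
  subtractions never truncate.
\<close>

definition rogers_ramanujan :: "complex \<Rightarrow> complex" where
  "rogers_ramanujan \<tau> = exp (2 * of_real pi * \<i> * \<tau> / 5) *
     (\<Prod>n. ((1 - nome \<tau> ^ (5 * Suc n - 1)) * (1 - nome \<tau> ^ (5 * Suc n - 4))) /
          ((1 - nome \<tau> ^ (5 * Suc n - 2)) * (1 - nome \<tau> ^ (5 * Suc n - 3))))"

definition rr_l :: "complex \<Rightarrow> complex" where
  "rr_l \<tau> = rogers_ramanujan (2 * \<tau>) / rogers_ramanujan \<tau> ^ 2"

end

theory Submission
  imports Defs "HOL-Complex_Analysis.Conformal_Mappings"
begin

text \<open>
  Put \<open>\<rho>(q) = (q, q^4; q^5) / (q^2, q^3; q^5)\<close> and \<open>L(q) = \<rho>(q^2) / \<rho>(q)^2\<close>, so that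
  \<open>l(\<tau>) = L(q)\<close>: the fractional powers of \<open>q\<close> cancel. By the Jacobi triple product, \<open>\<rho>(q)\<close>,
  \<open>\<rho>(q^2)\<close> and \<open>L(q)\<close> are quotients of theta functions in the nomes \<open>q^5\<close> and \<open>q^10\<close>. Splitting
  the product of two theta series by parity turns \<open>L(q)\<close> into a quotient \<open>(D + E) / (D - E)\<close> with
  \<open>E / D = q \<rho>(q) \<rho>(q^2)^2\<close>, which is the classical relation \<open>v - u^2 = u v^2 (v + u^2)\<close>
  between \<open>u = r(\<tau>)\<close> and \<open>v = r(2 \<tau>)\<close>.

  Eliminating \<open>\<rho>\<close> between this relation at \<open>q\<close> and at \<open>q^2\<close> gives, with \<open>M = L(q^2)\<close>,
  \<open>(L + 1)^2 (M - 1) = L (L - 1)^2 M^2 (M + 1)\<close>, whose difference of sides is, up to sign,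
  \<open>(1 + L - 2 L M - L M^2 + L^2 M^2) ((L - 1) M + L + 1)\<close>. The second factor is 2 at \<open>q = 0\<close>, so
  the first one vanishes near 0, and then on the whole unit disc by the identity theorem.
\<close>

section \<open>The q-binomial theorem\<close>

definition qpochhammer :: "nat \<Rightarrow> 'a :: comm_ring_1 \<Rightarrow> 'a \<Rightarrow> 'a" where
  "qpochhammer n a p = (\<Prod>k<n. 1 - a * p ^ k)"

lemma qpochhammer_0 [simp]: "qpochhammer 0 a p = 1"
  by (simp add: qpochhammer_def)

lemma qpochhammer_Suc: "qpochhammer (Suc n) a p = qpochhammer n a p * (1 - a * p ^ n)"
  by (simp add: qpochhammer_def)

lemma qpochhammer_Suc_shift: "qpochhammer (Suc n) a p = (1 - a) * qpochhammer n (a * p) p"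
  unfolding qpochhammer_def by (subst prod.lessThan_Suc_shift) (simp add: mult.assoc)

lemma qpochhammer_add: "qpochhammer (m + n) a p = qpochhammer m a p * qpochhammer n (a * p ^ m) p"
  by (induction n) (simp_all add: qpochhammer_Suc power_add algebra_simps)

lemma qpochhammer_split_even_odd:
  "qpochhammer (2 * n) a p = qpochhammer n a (p ^ 2) * qpochhammer n (a * p) (p ^ 2)"
  by (induction n) (simp_all add: qpochhammer_Suc algebra_simps flip: power_mult)

lemma qpochhammer_reverse:
  fixes x p :: "'a :: field"
  assumes "p \<noteq> 0" "x \<noteq> 0"
  shows "qpochhammer n (- (x / p ^ n)) p =
         x ^ n / p ^ (Suc n choose 2) * qpochhammer n (- (p / x)) p"
proof (induction n)
  case (Suc n)
  have choose: "Suc (Suc n) choose 2 = (Suc n choose 2) + Suc n"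
    by (simp add: numeral_2_eq_2)
  have "qpochhammer (Suc n) (- (x / p ^ Suc n)) p =
      (1 + x / p ^ Suc n) * qpochhammer n (- (x / p ^ n)) p"
    using assms by (subst qpochhammer_Suc_shift) simp
  also have "\<dots> = x ^ Suc n / p ^ (Suc (Suc n) choose 2) *
      ((1 + p / x * p ^ n) * qpochhammer n (- (p / x)) p)"
    unfolding Suc.IH choose using assms by (simp add: power_add field_simps)
  finally show ?case
    by (simp add: qpochhammer_Suc mult_ac)
qed (simp add: binomial_eq_0)

definition qbinomial :: "'a :: field \<Rightarrow> nat \<Rightarrow> nat \<Rightarrow> 'a" where
  "qbinomial p N j =
     (if j \<le> N then qpochhammer N p p / (qpochhammer j p p * qpochhammer (N - j) p p) else 0)"

lemma qpochhammer_nonzero_mono: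
  fixes a p :: "'a :: idom"
  assumes "qpochhammer n a p \<noteq> 0" "m \<le> n"
  shows "qpochhammer m a p \<noteq> 0"
  using assms by (auto simp: qpochhammer_def)

lemma qbinomial_0_right:
  assumes "qpochhammer N p p \<noteq> 0"
  shows "qbinomial p N 0 = 1"
  using assms by (simp add: qbinomial_def)

lemma qbinomial_Suc_Suc:
  assumes "qpochhammer (Suc N) p p \<noteq> 0"
  shows "qbinomial p (Suc N) (Suc j) = p ^ Suc j * qbinomial p N (Suc j) + qbinomial p N j"
proof (cases "j < N")
  case True
  then obtain i where N: "N = Suc (i + j)"
    by (metis add.commute add_Suc_right less_imp_Suc_add)
  have nonzero: "qpochhammer n p p \<noteq> 0" if "n \<le> Suc N" for n
    by (rule qpochhammer_nonzero_mono[OF assms that])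
  define s where "s = 1 - p ^ Suc j"
  define t where "t = 1 - p ^ Suc i"
  have "s \<noteq> 0" "t \<noteq> 0"
    using nonzero[of "Suc j"] nonzero[of "Suc i"] N by (simp_all add: qpochhammer_Suc s_def t_def)
  have "1 - p ^ Suc N = p ^ Suc j * t + s"
    by (simp add: s_def t_def N power_add right_diff_distrib mult_ac)
  then have "qbinomial p (Suc N) (Suc j) = qpochhammer N p p * (p ^ Suc j * t + s) /
      (qpochhammer j p p * s * (qpochhammer i p p * t))"
    by (simp add: qbinomial_def N qpochhammer_Suc s_def t_def)
  also have "\<dots> = p ^ Suc j * (qpochhammer N p p / (qpochhammer j p p * s * qpochhammer i p p)) +
      qpochhammer N p p / (qpochhammer j p p * (qpochhammer i p p * t))"
    using \<open>s \<noteq> 0\<close> \<open>t \<noteq> 0\<close> nonzero[of i] nonzero[of j] N by (simp add: field_simps)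
  also have "\<dots> = p ^ Suc j * qbinomial p N (Suc j) + qbinomial p N j"
    by (simp add: qbinomial_def N qpochhammer_Suc Suc_diff_le s_def t_def)
  finally show ?thesis .
next
  case False
  then show ?thesis
    using assms qpochhammer_nonzero_mono[OF assms, of N] by (auto simp: qbinomial_def)
qed

theorem qbinomial_theorem:
  assumes "qpochhammer N p p \<noteq> 0"
  shows "qpochhammer N (- x) p = (\<Sum>j\<le>N. qbinomial p N j * p ^ (j choose 2) * x ^ j)"
  using assms
proof (induction N arbitrary: x)
  case 0
  then show ?case by (simp add: qbinomial_def binomial_eq_0)
next
  case (Suc N)
  define c where "c = (\<lambda>n j. qbinomial p n j * p ^ (j choose 2))"
  have nonzero: "qpochhammer N p p \<noteq> 0"
    using qpochhammer_nonzero_mono[OF Suc.prems] by simp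
  have c_0: "c N 0 = 1" "c (Suc N) 0 = 1"
    using qbinomial_0_right nonzero Suc.prems by (auto simp: c_def binomial_eq_0)
  have c_Suc: "c (Suc N) (Suc j) = p ^ Suc j * c N (Suc j) + p ^ j * c N j" for j
    using qbinomial_Suc_Suc[OF Suc.prems, of j]
    by (simp add: c_def numeral_2_eq_2 power_add algebra_simps)
  have "c N (Suc N) = 0"
    by (simp add: c_def qbinomial_def)
  then have "(\<Sum>j\<le>N. c N j * (x * p) ^ j) = (\<Sum>j\<le>Suc N. c N j * (x * p) ^ j)"
    by simp
  also have "\<dots> = 1 + (\<Sum>j\<le>N. c N (Suc j) * (x * p) ^ Suc j)"
    by (subst sum.atMost_Suc_shift) (simp add: c_0)
  finally have shift: "(\<Sum>j\<le>N. c N j * (x * p) ^ j) = 1 + (\<Sum>j\<le>N. c N (Suc j) * (x * p) ^ Suc j)" .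
  have "qpochhammer (Suc N) (- x) p = (1 + x) * (\<Sum>j\<le>N. c N j * (x * p) ^ j)"
    using Suc.IH[OF nonzero, of "x * p"] by (simp add: qpochhammer_Suc_shift c_def)
  also have "\<dots> = (\<Sum>j\<le>N. c N j * (x * p) ^ j) + x * (\<Sum>j\<le>N. c N j * (x * p) ^ j)"
    by (simp add: distrib_right)
  also have "\<dots> = 1 + (\<Sum>j\<le>N. c N (Suc j) * (x * p) ^ Suc j + x * (c N j * (x * p) ^ j))"
    by (subst shift) (simp add: sum.distrib sum_distrib_left)
  also have "\<dots> = 1 + (\<Sum>j\<le>N. c (Suc N) (Suc j) * x ^ Suc j)"
    by (simp add: c_Suc power_mult_distrib algebra_simps)
  also have "\<dots> = (\<Sum>j\<le>Suc N. c (Suc N) j * x ^ j)"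
    by (subst sum.atMost_Suc_shift) (simp add: c_0)
  finally show ?case
    by (simp only: c_def)
qed

section \<open>Infinite q-Pochhammer symbols\<close>

definition qpochhammer_inf :: "'a :: {real_normed_field, banach} \<Rightarrow> 'a \<Rightarrow> 'a" where
  "qpochhammer_inf a p = (\<Prod>n. 1 - a * p ^ n)"

lemma convergent_prod_qpochhammer_inf:
  fixes a p :: "'a :: {real_normed_field, banach}"
  assumes "norm p < 1"
  shows "convergent_prod (\<lambda>n. 1 - a * p ^ n)"
proof -
  have "summable (\<lambda>n. norm ((1 - a * p ^ n) - 1))"
    using assms by (simp add: norm_mult norm_power summable_mult summable_geometric)
  then have "abs_convergent_prod (\<lambda>n. 1 - a * p ^ n)"
    by (simp add: abs_convergent_prod_conv_summable)
  then show ?thesis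
    by (rule abs_convergent_prod_imp_convergent_prod)
qed

lemma qpochhammer_LIMSEQ:
  assumes "norm p < 1"
  shows "(\<lambda>n. qpochhammer n a p) \<longlonglongrightarrow> qpochhammer_inf a p"
  using convergent_prod_LIMSEQ[OF convergent_prod_qpochhammer_inf[OF assms]]
  unfolding qpochhammer_def qpochhammer_inf_def LIMSEQ_lessThan_iff_atMost .

lemma qpochhammer_inf_one_left [simp]:
  assumes "norm p < 1"
  shows "qpochhammer_inf 1 p = 0"
proof (rule LIMSEQ_unique[OF qpochhammer_LIMSEQ[OF assms]])
  have "qpochhammer (Suc n) 1 p = 0" for n
    by (simp add: qpochhammer_Suc_shift)
  then show "(\<lambda>n. qpochhammer n 1 p) \<longlonglongrightarrow> 0"
    by (subst filterlim_sequentially_Suc[symmetric]) simp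
qed

lemma one_minus_mult_power_nonzero:
  fixes a p :: "'a :: real_normed_field"
  assumes "norm a < 1" "norm p < 1"
  shows "1 - a * p ^ n \<noteq> 0"
proof -
  have "norm (a * p ^ n) \<le> norm a * 1"
    unfolding norm_mult norm_power
    using assms by (intro mult_left_mono power_le_one) auto
  with assms have "norm (a * p ^ n) < 1" by simp
  then show ?thesis by auto
qed

lemma qpochhammer_nonzero:
  fixes a p :: "'a :: real_normed_field"
  assumes "norm a < 1" "norm p < 1"
  shows "qpochhammer n a p \<noteq> 0"
  using one_minus_mult_power_nonzero[OF assms] by (simp add: qpochhammer_def)

lemma qpochhammer_inf_nonzero:
  assumes "norm a < 1" "norm p < 1"
  shows "qpochhammer_inf a p \<noteq> 0"
  unfolding qpochhammer_inf_def
  using assms by (intro prodinf_nonzero convergent_prod_qpochhammer_inf one_minus_mult_power_nonzero)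

lemma norm_power_less_one:
  fixes q :: "'a :: real_normed_div_algebra"
  assumes "norm q < 1" "n > 0"
  shows "norm (q ^ n) < 1"
  using assms by (simp add: norm_power power_less_one_iff)

lemma filterlim_mult_2_sequentially: "filterlim (\<lambda>n. 2 * n) sequentially sequentially"
  by (rule filterlim_subseq) (simp add: strict_mono_def)

lemma qpochhammer_inf_split_even_odd:
  assumes "norm p < 1"
  shows "qpochhammer_inf a p = qpochhammer_inf a (p ^ 2) * qpochhammer_inf (a * p) (p ^ 2)"
proof (rule LIMSEQ_unique)
  show "(\<lambda>n. qpochhammer (2 * n) a p) \<longlonglongrightarrow> qpochhammer_inf a p"
    by (rule filterlim_compose[OF qpochhammer_LIMSEQ[OF assms] filterlim_mult_2_sequentially])
  show "(\<lambda>n. qpochhammer (2 * n) a p) \<longlonglongrightarrow> qpochhammer_inf a (p ^ 2) * qpochhammer_inf (a * p) (p ^ 2)"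
    unfolding qpochhammer_split_even_odd
    using assms by (intro tendsto_mult qpochhammer_LIMSEQ norm_power_less_one) auto
qed

lemma uniform_limit_qpochhammer:
  fixes f g :: "'a :: topological_space \<Rightarrow> 'b :: {real_normed_field, banach}"
  assumes "compact K" "K \<noteq> {}" and f: "continuous_on K f" and g: "continuous_on K g"
    and g_less: "\<And>x. x \<in> K \<Longrightarrow> norm (g x) < 1"
  shows "uniform_limit K (\<lambda>n x. qpochhammer n (f x) (g x))
           (\<lambda>x. qpochhammer_inf (f x) (g x)) sequentially"
proof -
  obtain B where B: "norm (f x) \<le> B" if "x \<in> K" for x
    using compact_imp_bounded[OF compact_continuous_image[OF f \<open>compact K\<close>]]
    by (auto simp: bounded_iff)
  obtain x0 where x0: "x0 \<in> K" and max: "\<And>x. x \<in> K \<Longrightarrow> norm (g x) \<le> norm (g x0)"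
    using continuous_attains_sup[OF \<open>compact K\<close> \<open>K \<noteq> {}\<close> continuous_on_norm[OF g]] by blast
  have "uniformly_convergent_on K (\<lambda>N x. \<Sum>n<N. norm ((1 - f x * g x ^ n) - 1))"
  proof (rule Weierstrass_m_test')
    fix n x assume x: "x \<in> K"
    have "norm (f x) * norm (g x) ^ n \<le> B * norm (g x0) ^ n"
      using order_trans[OF norm_ge_zero B[OF x]] by (intro mult_mono power_mono B max x) auto
    then show "norm (norm ((1 - f x * g x ^ n) - 1)) \<le> B * norm (g x0) ^ n"
      by (simp add: norm_mult norm_power)
  next
    show "summable (\<lambda>n. B * norm (g x0) ^ n)"
      using g_less[OF x0] by (intro summable_mult summable_geometric) simp
  qed
  then have "uniformly_convergent_on K (\<lambda>n x. qpochhammer n (f x) (g x))"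
    unfolding qpochhammer_def
    by (intro uniformly_convergent_on_prod' continuous_intros f g \<open>compact K\<close>)
  then obtain h where h: "uniform_limit K (\<lambda>n x. qpochhammer n (f x) (g x)) h sequentially"
    by (auto simp: uniformly_convergent_on_def)
  have "h x = qpochhammer_inf (f x) (g x)" if "x \<in> K" for x
    using tendsto_uniform_limitI[OF h that] qpochhammer_LIMSEQ[OF g_less[OF that]]
    by (rule LIMSEQ_unique)
  then show ?thesis
    using h by (simp cong: uniform_limit_cong')
qed

lemma holomorphic_on_qpochhammer_inf:
  assumes "open A" and f: "f holomorphic_on A" and g: "g holomorphic_on A"
    and g_less: "\<And>z. z \<in> A \<Longrightarrow> norm (g z) < 1"
  shows "(\<lambda>z. qpochhammer_inf (f z) (g z)) holomorphic_on A"
proof (rule holomorphic_uniform_sequence[OF \<open>open A\<close>])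
  show "(\<lambda>z. qpochhammer n (f z) (g z)) holomorphic_on A" for n
    unfolding qpochhammer_def by (intro holomorphic_intros f g)
  fix z assume "z \<in> A"
  then obtain d where d: "d > 0" "cball z d \<subseteq> A"
    using \<open>open A\<close> open_contains_cball by blast
  have "uniform_limit (cball z d) (\<lambda>n z. qpochhammer n (f z) (g z))
      (\<lambda>z. qpochhammer_inf (f z) (g z)) sequentially"
    using d g_less holomorphic_on_subset[OF f d(2)] holomorphic_on_subset[OF g d(2)]
    by (intro uniform_limit_qpochhammer holomorphic_on_imp_continuous_on) auto
  with d show "\<exists>d>0. cball z d \<subseteq> A \<and> uniform_limit (cball z d) (\<lambda>n z. qpochhammer n (f z) (g z))
      (\<lambda>z. qpochhammer_inf (f z) (g z)) sequentially"
    by blast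
qed

lemma qbinomial_bounded:
  fixes p :: "'a :: {real_normed_field, banach}"
  assumes "norm p < 1"
  obtains K where "\<And>N j. norm (qbinomial p N j) \<le> K"
proof -
  have "Bseq (\<lambda>n. qpochhammer n p p)"
    using qpochhammer_LIMSEQ[OF assms] by (rule convergentI[THEN convergent_imp_Bseq])
  then obtain A where A: "A > 0" "\<And>n. norm (qpochhammer n p p) \<le> A"
    by (auto elim: BseqE)
  have "(\<lambda>n. inverse (qpochhammer n p p)) \<longlonglongrightarrow> inverse (qpochhammer_inf p p)"
    using assms by (intro tendsto_inverse qpochhammer_LIMSEQ qpochhammer_inf_nonzero)
  then have "Bseq (\<lambda>n. inverse (qpochhammer n p p))"
    by (rule convergentI[THEN convergent_imp_Bseq])
  then obtain B where B: "B > 0" "\<And>n. norm (inverse (qpochhammer n p p)) \<le> B"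
    by (auto elim: BseqE)
  have "norm (qbinomial p N j) \<le> A * (B * B)" for N j
  proof (cases "j \<le> N")
    case True
    then have "norm (qbinomial p N j) = norm (qpochhammer N p p) *
        (norm (inverse (qpochhammer j p p)) * norm (inverse (qpochhammer (N - j) p p)))"
      by (simp add: qbinomial_def norm_mult norm_divide norm_inverse divide_inverse)
    also have "\<dots> \<le> A * (B * B)"
      using A(1) B(1) by (intro mult_mono A B) auto
    finally show ?thesis .
  qed (use A(1) B(1) in \<open>simp add: qbinomial_def\<close>)
  then show ?thesis by (rule that)
qed

definition central_qbinomial :: "'a :: field \<Rightarrow> nat \<Rightarrow> int \<Rightarrow> 'a" where
  "central_qbinomial p n i =
     (if i \<in> {-int n..int n} then qbinomial p (2 * n) (nat (int n + i)) else 0)"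

lemma central_qbinomial_bounded:
  fixes p :: "'a :: {real_normed_field, banach}"
  assumes "norm p < 1"
  obtains K where "\<And>n i. norm (central_qbinomial p n i) \<le> K"
proof -
  obtain K where K: "\<And>N j. norm (qbinomial p N j) \<le> K"
    using qbinomial_bounded[OF assms] by blast
  then have "norm (central_qbinomial p n i) \<le> K" for n i
    using order_trans[OF norm_ge_zero K] by (simp add: central_qbinomial_def)
  then show ?thesis by (rule that)
qed

lemma central_qbinomial_LIMSEQ:
  fixes p :: "'a :: {real_normed_field, banach}"
  assumes "norm p < 1"
  shows "(\<lambda>n. central_qbinomial p n i) \<longlonglongrightarrow> inverse (qpochhammer_inf p p)"
proof -
  let ?P = "\<lambda>n. qpochhammer n p p"
  have shift: "filterlim (\<lambda>n. nat (int n + k)) sequentially sequentially" for k :: int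
    unfolding filterlim_at_top eventually_sequentially
  proof
    show "\<exists>N. \<forall>n\<ge>N. Z \<le> nat (int n + k)" for Z
      by (intro exI[of _ "nat (int Z - k)"]) auto
  qed
  have nonzero: "qpochhammer_inf p p \<noteq> 0"
    by (rule qpochhammer_inf_nonzero[OF assms assms])
  then have "(\<lambda>n. ?P (2 * n) / (?P (nat (int n + i)) * ?P (nat (int n + (- i))))) \<longlonglongrightarrow>
      qpochhammer_inf p p / (qpochhammer_inf p p * qpochhammer_inf p p)"
    by (intro tendsto_divide tendsto_mult filterlim_compose[OF qpochhammer_LIMSEQ[OF assms]]
        shift filterlim_mult_2_sequentially) auto
  moreover have "eventually (\<lambda>n. ?P (2 * n) / (?P (nat (int n + i)) * ?P (nat (int n + (- i)))) =
      central_qbinomial p n i) sequentially"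
    using eventually_ge_at_top[of "nat \<bar>i\<bar>"]
  proof eventually_elim
    case (elim n)
    then have "i \<in> {-int n..int n}" "nat (int n + i) \<le> 2 * n"
        "2 * n - nat (int n + i) = nat (int n + (- i))"
      by auto
    then show ?case by (simp add: central_qbinomial_def qbinomial_def)
  qed
  ultimately show ?thesis
    using nonzero by (auto simp: inverse_eq_divide intro: Lim_transform_eventually)
qed

section \<open>The Jacobi triple product\<close>

definition int_choose_two :: "int \<Rightarrow> int" where
  "int_choose_two n = n * (n - 1) div 2"

lemma double_int_choose_two: "2 * int_choose_two n = n * (n - 1)"
  by (simp add: int_choose_two_def)

lemma int_choose_two_of_nat: "int_choose_two (int n) = int (n choose 2)"
proof -
  have "2 * int (n choose 2) = int n * (int n - 1)"
    by (induction n) (simp_all add: numeral_2_eq_2 algebra_simps)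
  then show ?thesis
    using double_int_choose_two[of "int n"] by simp
qed

definition theta_term :: "'a :: field \<Rightarrow> 'a \<Rightarrow> int \<Rightarrow> 'a" where
  "theta_term p x n = p powi int_choose_two n * x powi n"

text \<open>
  This is Ramanujan's \<open>f(x, p / x)\<close>; unlike the series in \<open>p ^ (n\<^sup>2)\<close> it needs no square root of
  \<open>q\<close> when specialised to the Rogers-Ramanujan products.
\<close>

definition theta :: "'a :: {real_normed_field, banach} \<Rightarrow> 'a \<Rightarrow> 'a" where
  "theta p x = (\<Sum>\<^sub>\<infinity>n. theta_term p x n)"

lemma theta_term_of_nat: "theta_term p x (int n) = p ^ (n choose 2) * x ^ n"
  unfolding theta_term_def int_choose_two_of_nat by (simp only: power_int_of_nat)

lemma theta_term_minus:
  assumes "p \<noteq> 0"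
  shows "theta_term p x (- n) = theta_term p (p / x) n"
proof -
  have "int_choose_two (- n) = int_choose_two n + n"
    using double_int_choose_two[of n] double_int_choose_two[of "- n"] by (simp add: algebra_simps)
  then have "theta_term p x (- n) = p powi int_choose_two n * (p powi n / x powi n)"
    using assms by (simp add: theta_term_def power_int_add power_int_minus_divide)
  then show ?thesis
    by (simp add: theta_term_def power_int_divide_distrib)
qed

lemma theta_term_add_1:
  assumes "p \<noteq> 0" "x \<noteq> 0"
  shows "theta_term p x (n + 1) = x * theta_term p (p * x) n"
proof -
  have "int_choose_two (n + 1) = int_choose_two n + n"
    using double_int_choose_two[of n] double_int_choose_two[of "n + 1"] by (simp add: algebra_simps)
  then show ?thesis
    using assms by (simp add: theta_term_def power_int_add power_int_mult_distrib)
qed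

lemma summable_power_choose_two:
  fixes r w :: real
  assumes "0 \<le> r" "r < 1" "0 \<le> w"
  shows "summable (\<lambda>n. r ^ (n choose 2) * w ^ n)"
proof -
  have "(\<lambda>n. r ^ n * w) \<longlonglongrightarrow> 0 * w"
    using assms by (intro tendsto_mult LIMSEQ_realpow_zero tendsto_const) auto
  then have "eventually (\<lambda>n. r ^ n * w < 1 / 2) sequentially"
    by (rule order_tendstoD) auto
  then obtain N where N: "\<And>n. n \<ge> N \<Longrightarrow> r ^ n * w < 1 / 2"
    by (auto simp: eventually_sequentially)
  show ?thesis
  proof (rule summable_ratio_test)
    fix n assume "n \<ge> N"
    have "r ^ (Suc n choose 2) * w ^ Suc n = (r ^ n * w) * (r ^ (n choose 2) * w ^ n)"
      by (simp add: numeral_2_eq_2 power_add)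
    also have "\<dots> \<le> 1 / 2 * (r ^ (n choose 2) * w ^ n)"
      using assms N[OF \<open>n \<ge> N\<close>] by (intro mult_right_mono) auto
    finally show "norm (r ^ (Suc n choose 2) * w ^ Suc n) \<le> 1 / 2 * norm (r ^ (n choose 2) * w ^ n)"
      using assms by simp
  qed simp
qed

lemma theta_term_abs_summable:
  fixes p x :: "'a :: {real_normed_field, banach}"
  assumes "norm p < 1" "p \<noteq> 0"
  shows "(\<lambda>n. norm (theta_term p x n)) summable_on UNIV"
proof -
  have nonneg: "(\<lambda>n. norm (theta_term p y (int n))) summable_on UNIV" for y
  proof -
    have "summable (\<lambda>n. norm (theta_term p y (int n)))"
      using summable_power_choose_two[of "norm p" "norm y"] assms
      by (simp add: theta_term_of_nat norm_mult norm_power)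
    then show ?thesis
      by (subst summable_on_UNIV_nonneg_real_iff) simp_all
  qed
  have "(\<lambda>n. norm (theta_term p x n)) summable_on range int"
    using nonneg[of x] by (subst summable_on_reindex) (simp_all add: o_def)
  moreover have "inj (\<lambda>n. - int n)"
    by (simp add: inj_on_def)
  then have "(\<lambda>n. norm (theta_term p x n)) summable_on range (\<lambda>n. - int n)"
    using nonneg[of "p / x"] by (simp add: summable_on_reindex o_def theta_term_minus[OF assms(2)])
  ultimately have "(\<lambda>n. norm (theta_term p x n)) summable_on (range int \<union> range (\<lambda>n. - int n))"
    by (rule summable_on_union)
  also have "range int \<union> range (\<lambda>n. - int n) = UNIV"
    by (auto intro: int_cases2)
  finally show ?thesis .
qed

lemma theta_has_sum:
  assumes "norm p < 1" "p \<noteq> 0"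
  shows "(theta_term p x has_sum theta p x) UNIV"
  unfolding theta_def
  by (rule has_sum_infsum[OF abs_summable_summable[OF theta_term_abs_summable[OF assms]]])

lemma power_choose_two_eq_theta_term:
  assumes "p \<noteq> 0" "x \<noteq> 0"
  shows "p ^ (j choose 2) * (x / p ^ n) ^ j =
         x ^ n / p ^ (Suc n choose 2) * theta_term p x (int j - int n)"
proof -
  have exponent: "int_choose_two (int j - int n) =
      int (j choose 2) + int (Suc n choose 2) - int (n * j)"
    using double_int_choose_two[of "int j - int n"] double_int_choose_two[of "int j"]
      double_int_choose_two[of "int (Suc n)"]
    unfolding int_choose_two_of_nat by (simp add: algebra_simps)
  have "theta_term p x (int j - int n) =
      p ^ (j choose 2) * p ^ (Suc n choose 2) / p ^ (n * j) * (x ^ j / x ^ n)"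
    using assms by (simp add: theta_term_def exponent power_int_add power_int_diff flip: of_nat_mult)
  then show ?thesis
    using assms by (simp add: power_divide power_mult)
qed

text \<open>Up to a monomial, the left-hand side is \<open>qpochhammer (2 * n) (- (x / p ^ n)) p\<close>.\<close>

lemma finite_triple_product:
  assumes nonzero: "qpochhammer (2 * n) p p \<noteq> 0" "p \<noteq> 0" "x \<noteq> 0"
  shows "qpochhammer n (- x) p * qpochhammer n (- (p / x)) p =
         (\<Sum>i\<in>{-int n..int n}. central_qbinomial p n i * theta_term p x i)"
proof -
  define c where "c = x ^ n / p ^ (Suc n choose 2)"
  define y where "y = x / p ^ n"
  have "c * (qpochhammer n (- x) p * qpochhammer n (- (p / x)) p) =
      qpochhammer n (- y) p * qpochhammer n (- y * p ^ n) p"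
    using qpochhammer_reverse[OF nonzero(2,3), of n] nonzero by (simp add: c_def y_def)
  also have "\<dots> = qpochhammer (2 * n) (- y) p"
    unfolding mult_2 by (rule qpochhammer_add[symmetric])
  also have "\<dots> = (\<Sum>j\<le>2 * n. qbinomial p (2 * n) j * (p ^ (j choose 2) * y ^ j))"
    by (simp add: qbinomial_theorem[OF nonzero(1)] mult.assoc)
  also have "\<dots> = c * (\<Sum>j\<le>2 * n. qbinomial p (2 * n) j * theta_term p x (int j - int n))"
    unfolding y_def power_choose_two_eq_theta_term[OF nonzero(2,3)] sum_distrib_left
    by (simp add: c_def mult_ac)
  also have "(\<Sum>j\<le>2 * n. qbinomial p (2 * n) j * theta_term p x (int j - int n)) =
      (\<Sum>i\<in>{-int n..int n}. central_qbinomial p n i * theta_term p x i)"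
    by (rule sum.reindex_bij_witness[of _ "\<lambda>i. nat (int n + i)" "\<lambda>j. int j - int n"])
       (auto simp: central_qbinomial_def)
  finally show ?thesis
    using nonzero by (simp add: c_def)
qed

lemma tendsto_has_sum_dominated:
  fixes f :: "'i \<Rightarrow> 'b \<Rightarrow> 'c :: banach"
  assumes bound: "\<And>i y. i \<in> A \<Longrightarrow> norm (f i y) \<le> g i" and "g summable_on A"
    and sum: "\<And>y. ((\<lambda>i. f i y) has_sum S y) A"
    and lim: "\<And>i. i \<in> A \<Longrightarrow> (f i \<longlongrightarrow> h i) F" and "(h has_sum s) A"
  shows "(S \<longlongrightarrow> s) F"
proof (rule swap_uniform_limit')
  show "uniform_limit UNIV (\<lambda>X y. \<Sum>i\<in>X. f i y) S (finite_subsets_at_top A)"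
    by (rule Weierstrass_m_test_general'[OF bound sum \<open>g summable_on A\<close>])
  show "eventually (\<lambda>X. ((\<lambda>y. \<Sum>i\<in>X. f i y) \<longlongrightarrow> (\<Sum>i\<in>X. h i)) F) (finite_subsets_at_top A)"
    using lim by (auto simp: eventually_finite_subsets_at_top intro!: exI[of _ "{}"] tendsto_sum)
  show "((\<lambda>X. \<Sum>i\<in>X. h i) \<longlongrightarrow> s) (finite_subsets_at_top A)"
    using \<open>(h has_sum s) A\<close> by (simp add: has_sum_def)
qed auto

theorem jacobi_triple_product:
  fixes p x :: "'a :: {real_normed_field, banach}"
  assumes p: "norm p < 1" "p \<noteq> 0" and x: "x \<noteq> 0"
  shows "theta p x = qpochhammer_inf p p * qpochhammer_inf (- x) p * qpochhammer_inf (- (p / x)) p"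
proof -
  define P where "P = (\<lambda>n. qpochhammer n (- x) p * qpochhammer n (- (p / x)) p)"
  obtain K where K: "\<And>n i. norm (central_qbinomial p n i) \<le> K"
    using central_qbinomial_bounded[OF p(1)] by blast
  have "P \<longlonglongrightarrow> inverse (qpochhammer_inf p p) * theta p x"
  proof (rule tendsto_has_sum_dominated)
    show "norm (central_qbinomial p n i * theta_term p x i) \<le> K * norm (theta_term p x i)" for i n
      unfolding norm_mult by (intro mult_right_mono K norm_ge_zero)
    show "(\<lambda>i. K * norm (theta_term p x i)) summable_on UNIV"
      by (intro summable_on_cmult_right theta_term_abs_summable p)
    show "((\<lambda>i. central_qbinomial p n i * theta_term p x i) has_sum P n) UNIV" for n
      unfolding P_def finite_triple_product[OF qpochhammer_nonzero[OF p(1) p(1)] p(2) x]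
      by (rule has_sum_finite_neutralI[where B = "{-int n..int n}"])
         (auto simp: central_qbinomial_def)
    show "(\<lambda>n. central_qbinomial p n i * theta_term p x i) \<longlonglongrightarrow>
        inverse (qpochhammer_inf p p) * theta_term p x i" for i
      by (intro tendsto_mult central_qbinomial_LIMSEQ p tendsto_const)
    show "((\<lambda>i. inverse (qpochhammer_inf p p) * theta_term p x i) has_sum
        inverse (qpochhammer_inf p p) * theta p x) UNIV"
      by (intro has_sum_cmult_right theta_has_sum p)
  qed
  moreover have "P \<longlonglongrightarrow> qpochhammer_inf (- x) p * qpochhammer_inf (- (p / x)) p"
    unfolding P_def by (intro tendsto_mult qpochhammer_LIMSEQ p)
  ultimately have "inverse (qpochhammer_inf p p) * theta p x =
      qpochhammer_inf (- x) p * qpochhammer_inf (- (p / x)) p"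
    by (rule LIMSEQ_unique)
  then show ?thesis
    using qpochhammer_inf_nonzero[OF p(1) p(1)] by (simp add: field_simps)
qed

section \<open>Identities between theta functions\<close>

lemma theta_reflect:
  assumes "norm p < 1" "p \<noteq> 0" "x \<noteq> 0"
  shows "theta p (p / x) = theta p x"
  using assms by (simp add: jacobi_triple_product mult_ac)

lemma theta_minus_one:
  assumes "norm p < 1" "p \<noteq> 0"
  shows "theta p (- 1) = 0"
  using assms by (simp add: jacobi_triple_product)

lemma theta_nonzero:
  assumes "norm p < norm x" "norm x < 1" "p \<noteq> 0"
  shows "theta p x \<noteq> 0"
proof -
  have "x \<noteq> 0" "norm p < 1" "norm (p / x) < 1"
    using assms by (auto simp: norm_divide divide_less_eq)
  then show ?thesis
    using assms by (simp add: jacobi_triple_product qpochhammer_inf_nonzero)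
qed

lemma theta_mult_theta_square_nome:
  assumes p: "norm p < 1" "p \<noteq> 0" and x: "x \<noteq> 0"
  shows "qpochhammer_inf p p * (theta (p ^ 2) x * theta (p ^ 2) (p * x)) =
         qpochhammer_inf (p ^ 2) (p ^ 2) ^ 2 * theta p x"
proof -
  have "norm (p ^ 2) < 1"
    using p by (intro norm_power_less_one) auto
  moreover have "p ^ 2 / (p * x) = p / x" "p / x * p = p ^ 2 / x"
    using p by (simp_all add: power2_eq_square)
  ultimately show ?thesis
    using p x qpochhammer_inf_split_even_odd[OF p(1), of "- x"]
      qpochhammer_inf_split_even_odd[OF p(1), of "- (p / x)"]
    by (simp add: jacobi_triple_product power2_eq_square mult_ac)
qed

lemma has_sum_mult_abs_summable:
  fixes f :: "'i \<Rightarrow> 'c :: {real_normed_field, banach}" and g :: "'j \<Rightarrow> 'c"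
  assumes f: "(\<lambda>i. norm (f i)) summable_on A" "(f has_sum a) A"
    and g: "(\<lambda>j. norm (g j)) summable_on B" "(g has_sum b) B"
  shows "((\<lambda>(i, j). f i * g j) has_sum a * b) (A \<times> B)"
proof (rule has_sum_SigmaI)
  show "((\<lambda>j. case (i, j) of (i, j) \<Rightarrow> f i * g j) has_sum f i * b) B" for i
    using has_sum_cmult_right[OF g(2), of "f i"] by simp
  show "((\<lambda>i. f i * b) has_sum a * b) A"
    by (rule has_sum_cmult_left[OF f(2)])
  have "(\<lambda>z. norm (case z of (i, j) \<Rightarrow> f i * g j)) summable_on A \<times> B"
  proof (rule summable_on_SigmaI)
    show "((\<lambda>j. norm (case (i, j) of (i, j) \<Rightarrow> f i * g j)) has_sum
        norm (f i) * infsum (\<lambda>j. norm (g j)) B) B" for i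
      using has_sum_cmult_right[OF has_sum_infsum[OF g(1)], of "norm (f i)"]
      by (simp add: norm_mult)
    show "(\<lambda>i. norm (f i) * infsum (\<lambda>j. norm (g j)) B) summable_on A"
      by (rule summable_on_cmult_left[OF f(1)])
  qed simp
  then show "(\<lambda>(i, j). f i * g j) summable_on A \<times> B"
    by (rule abs_summable_summable)
qed

lemma theta_term_mult_even:
  assumes "p \<noteq> 0" "x \<noteq> 0" "y \<noteq> 0"
  shows "theta_term p x (a + b) * theta_term p y (a - b) =
         theta_term (p ^ 2) (x * y) a * theta_term (p ^ 2) (p * x / y) b"
proof -
  have "int_choose_two (a + b) + int_choose_two (a - b) =
      2 * int_choose_two a + 2 * int_choose_two b + b"
    using double_int_choose_two[of "a + b"] double_int_choose_two[of "a - b"]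
      double_int_choose_two[of a] double_int_choose_two[of b] by (simp add: algebra_simps)
  then have "p powi int_choose_two (a + b) * p powi int_choose_two (a - b) =
      p powi (2 * int_choose_two a) * p powi (2 * int_choose_two b) * p powi b"
    using assms by (simp flip: power_int_add)
  moreover have "x powi (a + b) * y powi (a - b) = (x * y) powi a * (x / y) powi b"
    using assms
    by (simp add: power_int_add power_int_diff power_int_mult_distrib power_int_divide_distrib)
  ultimately have "theta_term p x (a + b) * theta_term p y (a - b) =
      p powi (2 * int_choose_two a) * p powi (2 * int_choose_two b) * p powi b *
        ((x * y) powi a * (x / y) powi b)"
    unfolding theta_term_def by algebra
  then show ?thesis
    by (simp add: theta_term_def power_int_power power_int_mult_distrib power_int_divide_distrib
        mult_ac)
qed

lemma theta_term_mult_odd: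
  assumes "p \<noteq> 0" "x \<noteq> 0" "y \<noteq> 0"
  shows "theta_term p x (a + b) * theta_term p y (a - b + 1) =
         y * (theta_term (p ^ 2) (p * x * y) a * theta_term (p ^ 2) (x / y) b)"
  using assms theta_term_mult_even[of p x "p * y" a b] theta_term_add_1[of p y "a - b"]
  by (simp add: mult_ac)

lemma has_sum_int_pairs_by_parity:
  fixes f :: "int \<times> int \<Rightarrow> 'a :: topological_comm_monoid_add"
  assumes equal: "((\<lambda>(a, b). f (a + b, a - b)) has_sum s) UNIV"
    and opposite: "((\<lambda>(a, b). f (a + b, a - b + 1)) has_sum t) UNIV"
  shows "(f has_sum (s + t)) UNIV"
proof -
  define g h :: "int \<times> int \<Rightarrow> int \<times> int"
    where "g = (\<lambda>(a, b). (a + b, a - b))" and "h = (\<lambda>(a, b). (a + b, a - b + 1))"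
  have "inj g" "inj h"
    by (auto simp: inj_on_def g_def h_def)
  then have "(f has_sum s) (range g)" "(f has_sum t) (range h)"
    using equal opposite by (simp_all add: has_sum_reindex g_def h_def o_def case_prod_unfold)
  moreover have "range g \<inter> range h = {}"
  proof -
    have "even (fst z - snd z)" if "z \<in> range g" for z
      using that by (auto simp: g_def)
    moreover have "odd (fst z - snd z)" if "z \<in> range h" for z
      using that by (auto simp: h_def)
    ultimately show ?thesis by blast
  qed
  moreover have "range g \<union> range h = UNIV"
  proof -
    have "(m, n) \<in> range g \<union> range h" for m n
    proof (cases "even (m - n)")
      case True
      then obtain b where "m - n = 2 * b" by (elim evenE)
      then have "(m, n) = g (n + b, b)" by (simp add: g_def)
      then show ?thesis by blast
    next
      case False
      then obtain b where "m - n = 2 * b + 1" by (elim oddE)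
      then have "(m, n) = h (n + b, b + 1)" by (simp add: h_def)
      then show ?thesis by blast
    qed
    then show ?thesis by auto
  qed
  ultimately show ?thesis
    using has_sum_Un_disjoint[of f "range g" s "range h" t] by simp
qed

lemma theta_mult_has_sum:
  assumes "norm p < 1" "p \<noteq> 0"
  shows "((\<lambda>(m, n). theta_term p x m * theta_term p y n) has_sum theta p x * theta p y) UNIV"
  using has_sum_mult_abs_summable[OF theta_term_abs_summable theta_has_sum theta_term_abs_summable
      theta_has_sum, OF assms assms assms assms, of x y] by simp

theorem theta_mult:
  fixes p x y :: "'a :: {real_normed_field, banach}"
  assumes p: "norm p < 1" "p \<noteq> 0" and xy: "x \<noteq> 0" "y \<noteq> 0"
  shows "theta p x * theta p y = theta (p ^ 2) (x * y) * theta (p ^ 2) (p * x / y) +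
           y * (theta (p ^ 2) (p * x * y) * theta (p ^ 2) (x / y))"
proof -
  have p2: "norm (p ^ 2) < 1" "p ^ 2 \<noteq> 0"
    using norm_power_less_one[OF p(1), of 2] p(2) by simp_all
  show ?thesis
  proof (rule has_sum_unique[OF theta_mult_has_sum[OF p] has_sum_int_pairs_by_parity])
    show "((\<lambda>(a, b). case (a + b, a - b) of (m, n) \<Rightarrow> theta_term p x m * theta_term p y n)
        has_sum theta (p ^ 2) (x * y) * theta (p ^ 2) (p * x / y)) UNIV"
      using theta_mult_has_sum[OF p2, of "x * y" "p * x / y"]
      by (simp add: theta_term_mult_even[OF p(2) xy])
    show "((\<lambda>(a, b). case (a + b, a - b + 1) of (m, n) \<Rightarrow> theta_term p x m * theta_term p y n)
        has_sum y * (theta (p ^ 2) (p * x * y) * theta (p ^ 2) (x / y))) UNIV"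
      using has_sum_cmult_right[OF theta_mult_has_sum[OF p2], of y "p * x * y" "x / y"]
      by (simp add: theta_term_mult_odd[OF p(2) xy] case_prod_unfold)
  qed
qed

corollary theta_mult_minus:
  assumes p: "norm p < 1" "p \<noteq> 0" and x: "x \<noteq> 0"
  shows "theta p x * theta p (- x) = theta (p ^ 2) (- (x ^ 2)) * theta (p ^ 2) (- p)"
proof -
  have "theta (p ^ 2) (- 1) = 0"
    using norm_power_less_one[OF p(1), of 2] p(2) by (intro theta_minus_one) simp_all
  moreover have "p * x / - x = - p" "x / - x = - 1" "x * - x = - (x ^ 2)"
    using x by (simp_all add: power2_eq_square)
  ultimately show ?thesis
    using theta_mult[OF p x, of "- x"] x by simp
qed

section \<open>The relation of degree two for the Rogers-Ramanujan continued fraction\<close>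

definition rr_ratio :: "'a :: {real_normed_field, banach} \<Rightarrow> 'a" where
  "rr_ratio q = qpochhammer_inf q (q ^ 5) * qpochhammer_inf (q ^ 4) (q ^ 5) /
     (qpochhammer_inf (q ^ 2) (q ^ 5) * qpochhammer_inf (q ^ 3) (q ^ 5))"

lemma rr_ratio_0: "rr_ratio 0 = 1"
  by (simp add: rr_ratio_def qpochhammer_inf_def)

lemma qpochhammer_inf_power_nonzero:
  assumes "norm q < 1" "k > 0" "m > 0"
  shows "qpochhammer_inf (q ^ k) (q ^ m) \<noteq> 0"
  using assms by (intro qpochhammer_inf_nonzero norm_power_less_one)

lemma rr_ratio_nonzero:
  assumes "norm q < 1"
  shows "rr_ratio q \<noteq> 0"
  using qpochhammer_inf_power_nonzero[OF assms, of _ 5] qpochhammer_inf_power_nonzero[OF assms, of 1 5]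
  by (simp add: rr_ratio_def)

lemma holomorphic_on_rr_ratio: "rr_ratio holomorphic_on ball 0 1"
  unfolding rr_ratio_def[abs_def]
  by (intro holomorphic_intros holomorphic_on_qpochhammer_inf norm_power_less_one)
     (auto simp: qpochhammer_inf_power_nonzero)

lemma theta_power_nonzero:
  fixes q :: "'a :: {real_normed_field, banach}"
  assumes "norm q < 1" "q \<noteq> 0" "0 < k" "k < m"
  shows "theta (q ^ m) (- (q ^ k)) \<noteq> 0"
  using assms
  by (intro theta_nonzero) (auto simp: norm_power power_strict_decreasing power_less_one_iff)

lemma theta_power_reflect:
  fixes q :: "'a :: {real_normed_field, banach}"
  assumes "norm q < 1" "q \<noteq> 0" "k < m"
  shows "theta (q ^ m) (- (q ^ (m - k))) = theta (q ^ m) (- (q ^ k))"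
  using assms theta_reflect[of "q ^ m" "- (q ^ k)"] norm_power_less_one[of q m]
  by (simp add: power_diff)

lemma rr_ratio_eq_theta:
  assumes "norm q < 1" "q \<noteq> 0"
  shows "rr_ratio q = theta (q ^ 5) (- q) / theta (q ^ 5) (- (q ^ 2))"
proof -
  have "norm (q ^ 5) < 1" "qpochhammer_inf (q ^ 5) (q ^ 5) \<noteq> 0"
    using norm_power_less_one[OF assms(1), of 5] qpochhammer_inf_power_nonzero[OF assms(1), of 5 5]
    by simp_all
  moreover have "q ^ 5 / q = q ^ 4" "q ^ 5 / q ^ 2 = q ^ 3"
    using assms by (simp_all add: field_simps flip: power_add power_Suc)
  ultimately show ?thesis
    using assms by (simp add: rr_ratio_def jacobi_triple_product)
qed

lemma rr_ratio_eq_theta_nome_10: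
  assumes q: "norm q < 1" "q \<noteq> 0"
  shows "rr_ratio q = theta (q ^ 10) (- q) * theta (q ^ 10) (- (q ^ 4)) /
           (theta (q ^ 10) (- (q ^ 2)) * theta (q ^ 10) (- (q ^ 3)))"
proof -
  define c where "c = qpochhammer_inf (q ^ 5) (q ^ 5)"
  define d where "d = qpochhammer_inf (q ^ 10) (q ^ 10)"
  have c: "c \<noteq> 0" and d: "d \<noteq> 0"
    unfolding c_def d_def using q by (simp_all add: qpochhammer_inf_power_nonzero)
  have split: "d ^ 2 * theta (q ^ 5) (- (q ^ k)) =
      c * (theta (q ^ 10) (- (q ^ k)) * theta (q ^ 10) (- (q ^ (5 + k))))" for k
    using theta_mult_theta_square_nome[of "q ^ 5" "- (q ^ k)"] norm_power_less_one[OF q(1), of 5] q(2)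
    by (simp add: c_def d_def power_add flip: power_mult)
  have "rr_ratio q = d ^ 2 * theta (q ^ 5) (- (q ^ 1)) / (d ^ 2 * theta (q ^ 5) (- (q ^ 2)))"
    using d by (simp add: rr_ratio_eq_theta[OF q])
  also have "\<dots> = c * (theta (q ^ 10) (- q) * theta (q ^ 10) (- (q ^ 6))) /
      (c * (theta (q ^ 10) (- (q ^ 2)) * theta (q ^ 10) (- (q ^ 7))))"
    unfolding split by simp
  finally show ?thesis
    using theta_power_reflect[OF q, of 4 10] theta_power_reflect[OF q, of 3 10] c by simp
qed

lemma theta_nome_5_mult:
  fixes q :: "'a :: {real_normed_field, banach}"
  assumes q: "norm q < 1" "q \<noteq> 0"
  defines "C \<equiv> \<lambda>k. theta (q ^ 10) (- (q ^ k))"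
  shows "theta (q ^ 5) q * theta (q ^ 5) (- (q ^ 2)) = C 3 * C 4 + q * (C 1 * C 2)"
    and "theta (q ^ 5) (- q) * theta (q ^ 5) (q ^ 2) = C 3 * C 4 - q * (C 1 * C 2)"
proof -
  have "norm (q ^ 5) < 1" "q ^ 5 \<noteq> 0"
    using norm_power_less_one[OF q(1), of 5] q(2) by simp_all
  note theta_mult_q5 = theta_mult[OF this]
  have "q ^ 5 * q ^ 2 / q = q ^ 6" "q ^ 2 / q = q"
    using q by (simp_all add: power2_eq_square field_simps flip: power_add power_Suc)
  then have "theta (q ^ 5) q * theta (q ^ 5) (- (q ^ 2)) = C 3 * C 6 + q * (C 8 * C 1)"
    "theta (q ^ 5) (- q) * theta (q ^ 5) (q ^ 2) = C 3 * C 6 - q * (C 8 * C 1)"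
    using theta_mult_q5[of "- (q ^ 2)" q] theta_mult_q5[of "q ^ 2" "- q"] q
    by (simp_all add: C_def mult.commute flip: power_mult power_add power_Suc power_Suc2)
  moreover have "C 6 = C 4" "C 8 = C 2"
    using theta_power_reflect[OF q, of 4 10] theta_power_reflect[OF q, of 2 10]
    by (simp_all add: C_def)
  ultimately show "theta (q ^ 5) q * theta (q ^ 5) (- (q ^ 2)) = C 3 * C 4 + q * (C 1 * C 2)"
    "theta (q ^ 5) (- q) * theta (q ^ 5) (q ^ 2) = C 3 * C 4 - q * (C 1 * C 2)"
    by simp_all
qed

lemma rr_ratio_square_eq_theta:
  assumes q: "norm q < 1" "q \<noteq> 0"
  shows "rr_ratio (q ^ 2) = theta (q ^ 10) (- (q ^ 2)) / theta (q ^ 10) (- (q ^ 4))"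
  using rr_ratio_eq_theta[of "q ^ 2"] norm_power_less_one[OF q(1), of 2] q(2)
  by (simp flip: power_mult)

lemma rr_ratio_square_mult_theta:
  assumes q: "norm q < 1" "q \<noteq> 0"
  shows "rr_ratio (q ^ 2) * (theta (q ^ 5) (- q) * theta (q ^ 5) (q ^ 2)) =
         rr_ratio q ^ 2 * (theta (q ^ 5) q * theta (q ^ 5) (- (q ^ 2)))"
proof -
  define A where "A = (\<lambda>k. theta (q ^ 5) (- (q ^ k)))"
  define B where "B = (\<lambda>k. theta (q ^ 5) (q ^ k))"
  define C where "C = (\<lambda>k. theta (q ^ 10) (- (q ^ k)))"
  have "norm (q ^ 5) < 1" "q ^ 5 \<noteq> 0"
    using norm_power_less_one[OF q(1), of 5] q(2) by simp_all
  then have "A k * B k = C (2 * k) * C 5" for k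
    using theta_mult_minus[of "q ^ 5" "q ^ k"] q
    by (simp add: A_def B_def C_def mult.commute flip: power_mult)
  from this[of 1] this[of 2] have "A 1 * B 1 = C 2 * C 5" "A 2 * B 2 = C 4 * C 5"
    by simp_all
  moreover have "A 2 \<noteq> 0" "C 4 \<noteq> 0"
    unfolding A_def C_def using q by (intro theta_power_nonzero; simp)+
  moreover have "rr_ratio q = A 1 / A 2" "rr_ratio (q ^ 2) = C 2 / C 4"
    using rr_ratio_eq_theta[OF q] rr_ratio_square_eq_theta[OF q] by (simp_all add: A_def C_def)
  ultimately have "rr_ratio (q ^ 2) * (A 1 * B 2) = rr_ratio q ^ 2 * (B 1 * A 2)"
    by (simp add: divide_simps) algebra
  then show ?thesis
    by (simp add: A_def B_def)
qed

theorem rr_ratio_degree_two_relation: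
  assumes "norm q < 1"
  shows "rr_ratio (q ^ 2) - rr_ratio q ^ 2 =
           q * rr_ratio q * rr_ratio (q ^ 2) ^ 2 * (rr_ratio (q ^ 2) + rr_ratio q ^ 2)"
proof (cases "q = 0")
  case True
  then show ?thesis by (simp add: rr_ratio_0)
next
  case False
  note q = assms False
  define C where "C = (\<lambda>k. theta (q ^ 10) (- (q ^ k)))"
  define u where "u = rr_ratio q"
  define v where "v = rr_ratio (q ^ 2)"
  define D where "D = C 3 * C 4"
  define E where "E = q * (C 1 * C 2)"
  have C: "C k \<noteq> 0" if "0 < k" "k < 10" for k
    unfolding C_def using q that by (rule theta_power_nonzero)
  have u: "u = C 1 * C 4 / (C 2 * C 3)" and v: "v = C 2 / C 4"
    using rr_ratio_eq_theta_nome_10[OF q] rr_ratio_square_eq_theta[OF q]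
    by (simp_all add: u_def v_def C_def)
  have "E = q * u * v ^ 2 * D"
    unfolding u v using C[of 1] C[of 2] C[of 3] C[of 4]
    by (simp add: D_def E_def field_simps power2_eq_square)
  moreover have "v * (D - E) = u ^ 2 * (D + E)"
    using rr_ratio_square_mult_theta[OF q] theta_nome_5_mult[OF q]
    by (simp add: u_def v_def C_def D_def E_def)
  ultimately have "(v - u ^ 2) * D = q * u * v ^ 2 * (v + u ^ 2) * D"
    by algebra
  then show ?thesis
    using C[of 3] C[of 4] by (simp add: u_def v_def D_def)
qed

section \<open>The relation between \<open>L(q)\<close> and \<open>L(q^2)\<close>\<close>

definition rr_quot :: "'a :: {real_normed_field, banach} \<Rightarrow> 'a" where
  "rr_quot q = rr_ratio (q ^ 2) / rr_ratio q ^ 2"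

lemma rr_ratio_square_eq_rr_quot:
  assumes "norm q < 1"
  shows "rr_ratio (q ^ 2) = rr_quot q * rr_ratio q ^ 2"
  using rr_ratio_nonzero[OF assms] by (simp add: rr_quot_def)

lemma rr_quot_0: "rr_quot 0 = 1"
  by (simp add: rr_quot_def rr_ratio_0)

lemma holomorphic_on_power_argument:
  assumes "f holomorphic_on ball 0 1" "n > 0"
  shows "(\<lambda>q. f (q ^ n)) holomorphic_on ball 0 1"
proof (rule holomorphic_on_compose_gen[OF _ assms(1), of "\<lambda>q. q ^ n", unfolded o_def])
  show "(\<lambda>q. q ^ n) ` ball 0 1 \<subseteq> (ball 0 1 :: complex set)"
    using norm_power_less_one[OF _ assms(2)] by (auto simp del: norm_power)
qed (intro holomorphic_intros)

lemma holomorphic_on_rr_quot: "rr_quot holomorphic_on ball 0 1"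
  unfolding rr_quot_def[abs_def]
  by (intro holomorphic_intros holomorphic_on_rr_ratio holomorphic_on_power_argument)
     (auto simp: rr_ratio_nonzero)

lemma rr_quot_minus_1:
  assumes "norm q < 1"
  shows "rr_quot q - 1 = q * rr_ratio q * rr_ratio (q ^ 2) ^ 2 * (rr_quot q + 1)"
  using rr_ratio_degree_two_relation[OF assms] rr_ratio_nonzero[OF assms]
  by (simp add: rr_quot_def field_simps)

lemma rr_quot_elimination:
  assumes q: "norm q < 1"
  defines "l \<equiv> rr_quot q" and "m \<equiv> rr_quot (q ^ 2)"
  shows "(l + 1) ^ 2 * (m - 1) = l * (l - 1) ^ 2 * m ^ 2 * (m + 1)"
proof -
  define u where "u = rr_ratio q"
  define v where "v = rr_ratio (q ^ 2)"
  define w where "w = rr_ratio ((q ^ 2) ^ 2)"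
  have q2: "norm (q ^ 2) < 1"
    by (rule norm_power_less_one[OF q]) simp
  have "v = l * u ^ 2" "w = m * v ^ 2"
    using rr_ratio_square_eq_rr_quot[OF q] rr_ratio_square_eq_rr_quot[OF q2]
    by (simp_all add: u_def v_def w_def l_def m_def)
  moreover have "l - 1 = q * u * v ^ 2 * (l + 1)" "m - 1 = q ^ 2 * v * w ^ 2 * (m + 1)"
    using rr_quot_minus_1[OF q] rr_quot_minus_1[OF q2]
    by (simp_all only: u_def v_def w_def l_def m_def)
  ultimately show ?thesis
    by algebra
qed

lemma elimination_factorization:
  fixes l m :: "'a :: comm_ring_1"
  shows "(1 + l - 2 * l * m - l * m ^ 2 + l ^ 2 * m ^ 2) * ((l - 1) * m + l + 1) =
         l * (l - 1) ^ 2 * m ^ 2 * (m + 1) - (l + 1) ^ 2 * (m - 1)"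
  by (simp add: algebra_simps power2_eq_square)

lemma holomorphic_mult_eq_0D:
  assumes f: "f holomorphic_on S" and g: "g holomorphic_on S" and S: "open S" "connected S"
    and mult: "\<And>z. z \<in> S \<Longrightarrow> f z * g z = 0" and "\<xi> \<in> S" "g \<xi> \<noteq> 0" "w \<in> S"
  shows "f w = 0"
proof -
  have "isCont g \<xi>"
    using holomorphic_on_imp_continuous_on[OF g] S(1) \<open>\<xi> \<in> S\<close>
    by (simp add: continuous_on_eq_continuous_at)
  then obtain e where e: "e > 0" "\<And>z. dist \<xi> z < e \<Longrightarrow> g z \<noteq> 0"
    using continuous_at_avoid[of \<xi> g 0] \<open>g \<xi> \<noteq> 0\<close> by auto
  show ?thesis
  proof (rule analytic_continuation_open[of "ball \<xi> e \<inter> S" S f "\<lambda>_. 0"])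
    show "f z = 0" if "z \<in> ball \<xi> e \<inter> S" for z
      using that mult[of z] e(2)[of z] by auto
    show "ball \<xi> e \<inter> S \<noteq> {}"
      using e(1) \<open>\<xi> \<in> S\<close> centre_in_ball by blast
  qed (use assms in auto)
qed

theorem rr_quot_polynomial_relation:
  fixes q :: complex
  assumes "norm q < 1"
  shows "1 + rr_quot q - 2 * rr_quot q * rr_quot (q ^ 2) - rr_quot q * rr_quot (q ^ 2) ^ 2
           + rr_quot q ^ 2 * rr_quot (q ^ 2) ^ 2 = 0"
proof (rule holomorphic_mult_eq_0D[where S = "ball 0 1" and \<xi> = 0 and w = q
      and g = "\<lambda>q. (rr_quot q - 1) * rr_quot (q ^ 2) + rr_quot q + 1"])
  show "(1 + rr_quot z - 2 * rr_quot z * rr_quot (z ^ 2) - rr_quot z * rr_quot (z ^ 2) ^ 2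
           + rr_quot z ^ 2 * rr_quot (z ^ 2) ^ 2) *
        ((rr_quot z - 1) * rr_quot (z ^ 2) + rr_quot z + 1) = 0"
    if "z \<in> ball 0 1" for z :: complex
    using rr_quot_elimination[of z] that unfolding elimination_factorization by simp
qed (use assms in \<open>auto intro!: holomorphic_intros holomorphic_on_rr_quot
      holomorphic_on_power_argument simp: rr_quot_0\<close>)

section \<open>Passage to the upper half-plane\<close>

lemma norm_nome_less_one:
  assumes "Im \<tau> > 0"
  shows "norm (nome \<tau>) < 1"
  using assms by (simp add: nome_def)

lemma nome_double: "nome (2 * \<tau>) = nome \<tau> ^ 2"
  by (simp add: nome_def mult_ac flip: exp_double)

lemma rogers_ramanujan_eq:
  assumes "Im \<tau> > 0"
  shows "rogers_ramanujan \<tau> = exp (2 * of_real pi * \<i> * \<tau> / 5) * rr_ratio (nome \<tau>)"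
proof -
  define q where "q = nome \<tau>"
  have power_split: "q ^ (5 * Suc n - 1) = q ^ 4 * (q ^ 5) ^ n" "q ^ (5 * Suc n - 4) = q * (q ^ 5) ^ n"
    "q ^ (5 * Suc n - 2) = q ^ 3 * (q ^ 5) ^ n" "q ^ (5 * Suc n - 3) = q ^ 2 * (q ^ 5) ^ n" for n
    by (simp_all flip: power_mult power_add power_Suc)
  have "norm (q ^ 5) < 1"
    unfolding q_def by (intro norm_power_less_one norm_nome_less_one[OF assms]) simp
  then have "(\<Prod>n. ((1 - q ^ (5 * Suc n - 1)) * (1 - q ^ (5 * Suc n - 4))) /
      ((1 - q ^ (5 * Suc n - 2)) * (1 - q ^ (5 * Suc n - 3)))) = rr_ratio q"
    unfolding power_split rr_ratio_def qpochhammer_inf_def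
    by (simp add: prodinf_divide[symmetric] prodinf_mult[symmetric] convergent_prod_qpochhammer_inf
        convergent_prod_mult mult.commute)
  then show ?thesis
    by (simp add: rogers_ramanujan_def q_def)
qed

lemma rr_l_eq_rr_quot:
  assumes "Im \<tau> > 0"
  shows "rr_l \<tau> = rr_quot (nome \<tau>)"
proof -
  have "exp (2 * of_real pi * \<i> * (2 * \<tau>) / 5) = exp (2 * of_real pi * \<i> * \<tau> / 5) ^ 2"
    by (simp add: mult_ac flip: exp_double)
  then show ?thesis
    using assms by (simp add: rr_l_def rr_quot_def rogers_ramanujan_eq nome_double power_mult_distrib)
qed

theorem theorem4p5:
  fixes \<tau> :: complex
  assumes "Im \<tau> > 0"
  shows "1 + rr_l \<tau> - 2 * rr_l \<tau> * rr_l (2 * \<tau>) - rr_l \<tau> * rr_l (2 * \<tau>) ^ 2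
           + rr_l \<tau> ^ 2 * rr_l (2 * \<tau>) ^ 2 = 0"
  using rr_quot_polynomial_relation[OF norm_nome_less_one[OF assms]] assms
  by (simp add: rr_l_eq_rr_quot nome_double)

end
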